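(* Let $Q=(Q,\cdot)$ be a connected quandle, $e\in Q$, and let $G=\mathrm{RMlt}(Q)$. Then $\mathrm{Aut}(Q)$ is isomorphic to $$\left(G\rtimes\mathrm{Aut}(G)_{R_e,G_e}\right)/\{(\alpha,\phi_\alpha^{-1})\,:\,\alpha\in G_e\}.$$
   Context: Mappings are applied on the right, as superscripts: $x^{\alpha\beta}=(x^\alpha)^\beta$. A quandle is a set $Q$ with a binary operation such that for every $x\in Q$ the right translation $R_x:Q\to Q$, $y\mapsto yx$, is an automorphism of $Q$, and $xx=x$ for all $x\in Q$. $\mathrm{RMlt}(Q)=\langle R_x:x\in Q\rangle\le\mathrm{Aut}(Q)$; $Q$ is connected if $\mathrm{RMlt}(Q)$ acts transitively on $Q$. $G_e$ is the stabilizer of $e$ in $G$. For a group $G$, a subgroup $H\le G$ and $x\in G$, $\mathrm{Aut}(G)_{x,H}=\{\psi\in\mathrm{Aut}(G) : x^\psi=x,\ H^\psi=H\}\le\mathrm{Aut}(G)$. For $\alpha\in G$, $\phi_\alpha$ is the conjugation $\beta\mapsto\alpha^{-1}\beta\alpha$ on $G$. The semidirect product $G\rtimes\mathrm{Aut}(G)_{R_e,G_e}$ is taken with respect to the natural action, with multiplication $(\alpha,\varphi)(\beta,\psi)=(\alpha\,\beta^{\varphi^{-1}},\varphi\psi)$, where $\varphi\psi$ means first $\varphi$, then $\psi$. *)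

theory Defs
  imports "HOL-Algebra.Group_Action" "HOL-Algebra.Elementary_Groups"
begin

text \<open>
  Mappings act on the right: the product of \<open>f\<close> and \<open>g\<close> is ``first \<open>f\<close>, then \<open>g\<close>''. This is
  opposite to \<^const>\<open>BijGroup\<close> and \<^const>\<open>AutoGroup\<close>, whose carriers are reused below. As there,
  permutations of a set are represented by functions that are \<^const>\<open>extensional\<close> on it.
\<close>

definition right_perm_group :: "'a set \<Rightarrow> ('a \<Rightarrow> 'a) monoid" where
  "right_perm_group S = \<lparr>carrier = Bij S, monoid.mult = (\<lambda>f g. compose S g f), one = (\<lambda>x\<in>S. x)\<rparr>"

subsection \<open>Quandles\<close>

definition right_translation :: "'a set \<Rightarrow> ('a \<Rightarrow> 'a \<Rightarrow> 'a) \<Rightarrow> 'a \<Rightarrow> 'a \<Rightarrow> 'a" where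
  "right_translation Q m x = (\<lambda>y\<in>Q. m y x)"

definition quandle_auto :: "'a set \<Rightarrow> ('a \<Rightarrow> 'a \<Rightarrow> 'a) \<Rightarrow> ('a \<Rightarrow> 'a) set" where
  "quandle_auto Q m = {f \<in> Bij Q. \<forall>x\<in>Q. \<forall>y\<in>Q. f (m x y) = m (f x) (f y)}"

definition quandle :: "'a set \<Rightarrow> ('a \<Rightarrow> 'a \<Rightarrow> 'a) \<Rightarrow> bool" where
  "quandle Q m \<longleftrightarrow>
     m \<in> Q \<rightarrow> Q \<rightarrow> Q \<and>
     (\<forall>x\<in>Q. right_translation Q m x \<in> quandle_auto Q m) \<and>
     (\<forall>x\<in>Q. m x x = x)"

definition quandle_Aut :: "'a set \<Rightarrow> ('a \<Rightarrow> 'a \<Rightarrow> 'a) \<Rightarrow> ('a \<Rightarrow> 'a) monoid" where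
  "quandle_Aut Q m = (right_perm_group Q) \<lparr>carrier := quandle_auto Q m\<rparr>"

definition RMlt :: "'a set \<Rightarrow> ('a \<Rightarrow> 'a \<Rightarrow> 'a) \<Rightarrow> ('a \<Rightarrow> 'a) monoid" where
  "RMlt Q m = subgroup_generated (quandle_Aut Q m) (right_translation Q m ` Q)"

definition connected_quandle :: "'a set \<Rightarrow> ('a \<Rightarrow> 'a \<Rightarrow> 'a) \<Rightarrow> bool" where
  "connected_quandle Q m \<longleftrightarrow>
     quandle Q m \<and> (\<forall>x\<in>Q. \<forall>y\<in>Q. \<exists>\<alpha>\<in>carrier (RMlt Q m). \<alpha> x = y)"

subsection \<open>Groups\<close>

definition Aut_fixing :: "('a, 'b) monoid_scheme \<Rightarrow> 'a \<Rightarrow> 'a set \<Rightarrow> ('a \<Rightarrow> 'a) monoid" where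
  "Aut_fixing G x H =
     (right_perm_group (carrier G)) \<lparr>carrier := {\<psi> \<in> auto G. \<psi> x = x \<and> \<psi> ` H = H}\<rparr>"

definition conj_by :: "('a, 'b) monoid_scheme \<Rightarrow> 'a \<Rightarrow> 'a \<Rightarrow> 'a" where
  "conj_by G \<alpha> = (\<lambda>\<beta>\<in>carrier G. inv\<^bsub>G\<^esub> \<alpha> \<otimes>\<^bsub>G\<^esub> \<beta> \<otimes>\<^bsub>G\<^esub> \<alpha>)"

text \<open>Semidirect product of \<open>G\<close> with a group \<open>A\<close> of automorphisms of \<open>G\<close> acting naturally.\<close>

definition semidirect ::
    "('a, 'b) monoid_scheme \<Rightarrow> ('a \<Rightarrow> 'a, 'c) monoid_scheme \<Rightarrow> ('a \<times> ('a \<Rightarrow> 'a)) monoid" where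
  "semidirect G A =
     \<lparr>carrier = carrier G \<times> carrier A,
      monoid.mult = (\<lambda>(\<alpha>, \<phi>) (\<beta>, \<psi>). (\<alpha> \<otimes>\<^bsub>G\<^esub> (inv\<^bsub>A\<^esub> \<phi>) \<beta>, \<phi> \<otimes>\<^bsub>A\<^esub> \<psi>)),
      one = (\<one>\<^bsub>G\<^esub>, \<one>\<^bsub>A\<^esub>)\<rparr>"

end

theory Submission
  imports Defs
begin

text \<open>
  An automorphism \<open>\<psi>\<close> of \<open>G\<close> fixing \<open>R\<^sub>e\<close> and \<open>G\<^sub>e\<close> induces on \<open>Q = e\<^sup>G\<close> the map
  \<open>e\<^sup>\<beta> \<mapsto> e\<^bsup>\<psi>(\<beta>)\<^esup>\<close>, called \<open>lift \<psi>\<close> below. It is an automorphism of \<open>Q\<close> because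
  \<open>R\<^bsub>e\<beta>\<^esub> = \<beta>\<^sup>-\<^sup>1R\<^sub>e\<beta>\<close>, and it conjugates \<open>\<beta>\<close> to \<open>\<psi>(\<beta>)\<close>. Hence \<open>(\<alpha>, \<psi>) \<mapsto> \<alpha> (lift \<psi>)\<close> is a
  homomorphism from the semidirect product to \<open>Aut(Q)\<close>. It is onto, since by connectedness every
  automorphism is the product of some \<open>\<alpha> \<in> G\<close> and an automorphism \<open>g\<close> fixing \<open>e\<close>, and \<open>g\<close> is the
  lift of the conjugation by \<open>g\<close>. If \<open>\<alpha> (lift \<psi>) = 1\<close> then \<open>\<alpha>\<close> fixes \<open>e\<close> and \<open>\<psi>\<close> is the conjugation
  by \<open>\<alpha>\<^sup>-\<^sup>1\<close>.
\<close>

section \<open>Permutation groups acting on the right\<close>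

lemma (in group) mult_inv_cancel:
  assumes "x \<in> carrier G" "y \<in> carrier G"
  shows "x \<otimes> (inv x \<otimes> y) = y" and "inv x \<otimes> (x \<otimes> y) = y"
  using assms by (simp_all flip: m_assoc)

text \<open>Common interface for the two permutation groups of the argument: the automorphisms of
  \<open>Q\<close>, acting on \<open>Q\<close>, and \<open>Aut_fixing\<close>, acting on the carrier
  of a group.\<close>

locale right_perm = group H for S :: "'a set" and H :: "('a \<Rightarrow> 'a) monoid" (structure) +
  assumes carrier_Bij: "carrier H \<subseteq> Bij S"
    and mult_eq: "f \<otimes> g = compose S g f"
    and one_eq: "\<one> = (\<lambda>x\<in>S. x)"
begin

lemma act_closed:
  assumes "f \<in> carrier H" "x \<in> S" shows "f x \<in> S"
  using Bij_imp_funcset[OF subsetD[OF carrier_Bij assms(1)]] assms(2) by (rule funcset_mem)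

lemma act_mult: "x \<in> S \<Longrightarrow> (f \<otimes> g) x = g (f x)"
  by (simp add: mult_eq compose_def)

lemma act_one: "x \<in> S \<Longrightarrow> \<one> x = x"
  by (simp add: one_eq)

lemma act_inv: "f \<in> carrier H \<Longrightarrow> x \<in> S \<Longrightarrow> (inv f) (f x) = x"
  by (simp flip: act_mult) (simp add: act_one)

lemma act_inv': "f \<in> carrier H \<Longrightarrow> x \<in> S \<Longrightarrow> f ((inv f) x) = x"
  by (simp flip: act_mult) (simp add: act_one)

lemma act_ext:
  assumes "f \<in> carrier H" "g \<in> carrier H" "\<And>x. x \<in> S \<Longrightarrow> f x = g x"
  shows "f = g"
proof (rule extensionalityI)
  show "f \<in> extensional S" "g \<in> extensional S"
    using assms(1,2) carrier_Bij Bij_imp_extensional by blast+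
qed (rule assms(3))

lemma act_inj: "f \<in> carrier H \<Longrightarrow> x \<in> S \<Longrightarrow> y \<in> S \<Longrightarrow> f x = f y \<Longrightarrow> x = y"
  by (drule arg_cong[where f = "inv f"]) (simp add: act_inv)

end

lemma right_perm_group: "right_perm S (right_perm_group S)"
proof -
  interpret group "right_perm_group S"
  proof (rule groupI)
    fix f assume "f \<in> carrier (right_perm_group S)"
    then have f: "f \<in> Bij S" by (simp add: right_perm_group_def)
    \<comment> \<open>Products reverse composition, so a left inverse in the group is a right
      inverse of functions.\<close>
    have "compose S f (\<lambda>x\<in>S. inv_into S f x) = (\<lambda>x\<in>S. x)"
      using f by (auto simp: Bij_def compose_def bij_betw_inv_into_right)
    then show "\<exists>g\<in>carrier (right_perm_group S).
        g \<otimes>\<^bsub>right_perm_group S\<^esub> f = \<one>\<^bsub>right_perm_group S\<^esub>"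
      using restrict_inv_into_Bij[OF f] by (auto simp: right_perm_group_def)
  qed (auto simp: right_perm_group_def compose_Bij id_Bij Bij_imp_funcset Bij_imp_extensional
      compose_assoc intro!: compose_Id)
  show ?thesis
    by unfold_locales (auto simp: right_perm_group_def)
qed

text \<open>Inverses in \<open>right_perm_group S\<close> are restricted \<open>inv_into\<close>
  maps, so the subgroup criterion can be stated with plain functions, the form in which
  \<open>Bij\<close> and \<open>auto\<close> are handled.\<close>

lemma right_perm_subgroup:
  assumes "K \<subseteq> Bij S" and "(\<lambda>x\<in>S. x) \<in> K"
    and "\<And>f g. f \<in> K \<Longrightarrow> g \<in> K \<Longrightarrow> compose S g f \<in> K"
    and "\<And>f. f \<in> K \<Longrightarrow> (\<lambda>x\<in>S. inv_into S f x) \<in> K"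
  shows "right_perm S (right_perm_group S\<lparr>carrier := K\<rparr>)"
proof -
  interpret P: right_perm S "right_perm_group S" by (rule right_perm_group)
  have inv: "inv\<^bsub>right_perm_group S\<^esub> f = (\<lambda>x\<in>S. inv_into S f x)" if "f \<in> Bij S" for f
  proof (rule P.inv_equality)
    show "(\<lambda>x\<in>S. inv_into S f x) \<otimes>\<^bsub>right_perm_group S\<^esub> f = \<one>\<^bsub>right_perm_group S\<^esub>"
      using that by (auto simp: right_perm_group_def Bij_def compose_def bij_betw_inv_into_right)
  qed (use that restrict_inv_into_Bij in \<open>auto simp: right_perm_group_def\<close>)
  have "subgroup K (right_perm_group S)"
  proof (rule P.subgroupI)
    show "K \<subseteq> carrier (right_perm_group S)" using assms(1) by (simp add: right_perm_group_def)
    show "K \<noteq> {}" using assms(2) by blast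
    show "inv\<^bsub>right_perm_group S\<^esub> f \<in> K" if "f \<in> K" for f
      using that assms(1,4) inv by (metis subsetD)
    show "f \<otimes>\<^bsub>right_perm_group S\<^esub> g \<in> K" if "f \<in> K" "g \<in> K" for f g
      using that assms(3) by (simp add: P.mult_eq)
  qed
  then interpret group "right_perm_group S\<lparr>carrier := K\<rparr>"
    by (rule P.subgroup_imp_group)
  show ?thesis
    by unfold_locales (use assms(1) in \<open>auto simp: P.mult_eq P.one_eq\<close>)
qed

lemma right_perm_Aut_fixing:
  assumes "group G" "x \<in> carrier G" "H \<subseteq> carrier G"
  shows "right_perm (carrier G) (Aut_fixing G x H)"
  unfolding Aut_fixing_def
proof (rule right_perm_subgroup)
  interpret G: group G by fact
  let ?K = "{\<psi> \<in> auto G. \<psi> x = x \<and> \<psi> ` H = H}"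
  show "?K \<subseteq> Bij (carrier G)" by (auto simp: auto_def)
  show "(\<lambda>x\<in>carrier G. x) \<in> ?K"
    using assms G.id_in_auto by (auto simp: image_iff)
  show "compose (carrier G) g f \<in> ?K" if "f \<in> ?K" "g \<in> ?K" for f g
  proof -
    have "compose (carrier G) g f \<in> auto G"
      using that by (auto simp: auto_def G.hom_compose compose_Bij)
    moreover have "compose (carrier G) g f ` H = g ` f ` H"
      unfolding image_image using assms(3) by (intro image_cong) (auto simp: compose_def)
    ultimately show ?thesis
      using that assms by (simp add: compose_def)
  qed
  show "(\<lambda>y\<in>carrier G. inv_into (carrier G) f y) \<in> ?K" if "f \<in> ?K" for f
  proof -
    let ?g = "\<lambda>y\<in>carrier G. inv_into (carrier G) f y"
    have f: "f \<in> Bij (carrier G)" "f \<in> hom G G" using that by (auto simp: auto_def)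
    then have inj: "inj_on f (carrier G)" by (auto simp: Bij_def bij_betw_def)
    have gf: "?g (f y) = y" if "y \<in> carrier G" for y
      using that inj f Bij_imp_funcset by auto
    have "?g \<in> auto G"
      using f G.restrict_inv_into_hom restrict_inv_into_Bij unfolding auto_def by blast
    moreover have "?g x = x" using gf[OF assms(2)] that by auto
    moreover have "?g ` H = H"
    proof -
      have "f ` H = H" using that by simp
      then have "?g ` H = (\<lambda>y. ?g (f y)) ` H" by (metis image_image)
      also have "\<dots> = (\<lambda>y. y) ` H"
        by (rule image_cong[OF refl]) (rule gf, use assms(3) in blast)
      also have "\<dots> = H" by simp
      finally show ?thesis .
    qed
    ultimately show ?thesis by blast
  qed
qed

section \<open>Semidirect products\<close>

lemma group_semidirect:
  assumes "group G" and "right_perm (carrier G) A" and "carrier A \<subseteq> hom G G"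
  shows "group (semidirect G A)"
proof -
  interpret G: group G by fact
  interpret A: right_perm "carrier G" A by fact
  have mult: "\<phi> (x \<otimes>\<^bsub>G\<^esub> y) = \<phi> x \<otimes>\<^bsub>G\<^esub> \<phi> y"
    if "\<phi> \<in> carrier A" "x \<in> carrier G" "y \<in> carrier G" for \<phi> x y
    using that assms(3) by (auto simp: hom_def)
  have one: "\<phi> \<one>\<^bsub>G\<^esub> = \<one>\<^bsub>G\<^esub>" if "\<phi> \<in> carrier A" for \<phi>
    using that assms(3) hom_one[OF _ assms(1) assms(1)] by blast
  note [simp] = A.act_closed A.act_mult A.act_one mult one
  show ?thesis
  proof (rule groupI)
    fix p assume "p \<in> carrier (semidirect G A)"
    then obtain \<alpha> \<phi> where p: "p = (\<alpha>, \<phi>)" "\<alpha> \<in> carrier G" "\<phi> \<in> carrier A"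
      by (auto simp: semidirect_def)
    \<comment> \<open>The left inverse of \<open>(\<alpha>, \<phi>)\<close> has second component
      \<open>inv \<phi>\<close>, so the product twists \<open>\<alpha>\<close> by
      \<open>inv (inv \<phi>) = \<phi>\<close>.\<close>
    have "\<phi> (inv\<^bsub>G\<^esub> \<alpha>) \<otimes>\<^bsub>G\<^esub> \<phi> \<alpha> = \<one>\<^bsub>G\<^esub>"
      using mult[OF p(3) G.inv_closed[OF p(2)] p(2)] one[OF p(3)] p(2) by simp
    then show "\<exists>q\<in>carrier (semidirect G A). q \<otimes>\<^bsub>semidirect G A\<^esub> p = \<one>\<^bsub>semidirect G A\<^esub>"
      using p by (intro bexI[of _ "(\<phi> (inv\<^bsub>G\<^esub> \<alpha>), inv\<^bsub>A\<^esub> \<phi>)"]) (auto simp: semidirect_def)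
  qed (auto simp: semidirect_def A.inv_mult_group G.m_assoc A.m_assoc)
qed

section \<open>Connected quandles with a base point\<close>

lemma right_perm_quandle_Aut:
  assumes "m \<in> Q \<rightarrow> Q \<rightarrow> Q"
  shows "right_perm Q (quandle_Aut Q m)"
  unfolding quandle_Aut_def
proof (rule right_perm_subgroup)
  have m: "m x y \<in> Q" if "x \<in> Q" "y \<in> Q" for x y
    using that assms by blast
  show "quandle_auto Q m \<subseteq> Bij Q" by (auto simp: quandle_auto_def)
  show "(\<lambda>x\<in>Q. x) \<in> quandle_auto Q m"
    using m by (auto simp: quandle_auto_def id_Bij)
  show "compose Q g f \<in> quandle_auto Q m" if "f \<in> quandle_auto Q m" "g \<in> quandle_auto Q m" for f g
  proof -
    have "f x \<in> Q" if "x \<in> Q" for x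
      using \<open>f \<in> quandle_auto Q m\<close> that Bij_imp_funcset by (auto simp: quandle_auto_def)
    moreover have "compose Q g f \<in> Bij Q"
      using that by (simp add: quandle_auto_def compose_Bij)
    ultimately show ?thesis
      using that m by (simp add: quandle_auto_def compose_eq)
  qed
  show "(\<lambda>x\<in>Q. inv_into Q f x) \<in> quandle_auto Q m" if "f \<in> quandle_auto Q m" for f
    using that m restrict_inv_into_Bij[of f Q] Bij_inv_into_lemma[of Q f m] assms
    by (auto simp: quandle_auto_def)
qed

locale pointed_connected_quandle =
  fixes Q :: "'a set" and m :: "'a \<Rightarrow> 'a \<Rightarrow> 'a" and e :: 'a
  assumes connected: "connected_quandle Q m" and e: "e \<in> Q"
begin

abbreviation "U \<equiv> quandle_Aut Q m"
abbreviation "G \<equiv> RMlt Q m"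
abbreviation "R \<equiv> right_translation Q m"
abbreviation "Ge \<equiv> stabilizer G (\<lambda>\<alpha>. \<alpha>) e"
abbreviation "A \<equiv> Aut_fixing G (R e) Ge"

lemma quandle: "quandle Q m"
  using connected by (simp add: connected_quandle_def)

sublocale U: right_perm Q U
  by (rule right_perm_quandle_Aut) (use quandle in \<open>simp add: quandle_def\<close>)

lemma carrier_U: "carrier U = quandle_auto Q m"
  by (simp add: quandle_Aut_def)

lemma U_hom: "f \<in> carrier U \<Longrightarrow> x \<in> Q \<Longrightarrow> y \<in> Q \<Longrightarrow> f (m x y) = m (f x) (f y)"
  by (simp add: carrier_U quandle_auto_def)

lemma R_U: "x \<in> Q \<Longrightarrow> R x \<in> carrier U"
  using quandle by (simp add: quandle_def carrier_U)

lemma R_apply: "y \<in> Q \<Longrightarrow> R x y = m y x"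
  by (simp add: right_translation_def)

sublocale G: group G
  unfolding RMlt_def by (rule U.group_subgroup_generated)

text \<open>Elements of \<open>G\<close> get multiplied with arbitrary automorphisms of
  \<open>Q\<close>, so the operations of \<open>G\<close> are always rewritten to those of
  \<open>U\<close>.\<close>

lemma G_mult [simp]: "x \<otimes>\<^bsub>G\<^esub> y = x \<otimes>\<^bsub>U\<^esub> y"
  by (simp add: RMlt_def)

lemma G_one [simp]: "\<one>\<^bsub>G\<^esub> = \<one>\<^bsub>U\<^esub>"
  by (simp add: RMlt_def)

lemma G_inv [simp]: "x \<in> carrier G \<Longrightarrow> inv\<^bsub>G\<^esub> x = inv\<^bsub>U\<^esub> x"
  by (simp add: RMlt_def)

lemma G_subgroup: "subgroup (carrier G) U"
  unfolding RMlt_def by (rule U.subgroup_subgroup_generated)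

lemmas G_U = subgroup.mem_carrier[OF G_subgroup]
  and G_m_closed = subgroup.m_closed[OF G_subgroup]
  and G_inv_closed = subgroup.m_inv_closed[OF G_subgroup]

lemma carrier_G: "carrier G = generate U (R ` Q)"
  using R_U by (simp add: RMlt_def carrier_subgroup_generated inf_absorb2 image_subset_iff)

lemma R_G: "x \<in> Q \<Longrightarrow> R x \<in> carrier G"
  unfolding carrier_G by (intro generate.incl) auto

section \<open>Normality of \<open>RMlt(Q)\<close> in \<open>Aut(Q)\<close>\<close>

lemma R_conj:
  assumes f: "f \<in> carrier U" and x: "x \<in> Q"
  shows "inv\<^bsub>U\<^esub> f \<otimes>\<^bsub>U\<^esub> R x \<otimes>\<^bsub>U\<^esub> f = R (f x)"
proof (rule U.act_ext)
  fix y assume y: "y \<in> Q"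
  define z where "z = (inv\<^bsub>U\<^esub> f) y"
  have z: "z \<in> Q" "f z = y" using f y by (simp_all add: z_def U.act_closed U.act_inv')
  have "(inv\<^bsub>U\<^esub> f \<otimes>\<^bsub>U\<^esub> R x \<otimes>\<^bsub>U\<^esub> f) y = f (m z x)"
    using y z(1) by (simp add: U.act_mult R_apply flip: z_def)
  also have "\<dots> = R (f x) y"
    using U_hom[OF f z(1) x] y z(2) by (simp add: R_apply)
  finally show "(inv\<^bsub>U\<^esub> f \<otimes>\<^bsub>U\<^esub> R x \<otimes>\<^bsub>U\<^esub> f) y = R (f x) y" .
next
  show "R (f x) \<in> carrier U" by (rule R_U[OF U.act_closed[OF f x]])
  show "inv\<^bsub>U\<^esub> f \<otimes>\<^bsub>U\<^esub> R x \<otimes>\<^bsub>U\<^esub> f \<in> carrier U"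
    by (intro U.m_closed U.inv_closed R_U f x)
qed

text \<open>By \<open>R_conj\<close>, conjugation by an automorphism sends translations to
  translations; these generate \<open>G\<close>, and conjugation respects products and
  inverses.\<close>

lemma G_conj:
  assumes f: "f \<in> carrier U" and \<beta>: "\<beta> \<in> carrier G"
  shows "inv\<^bsub>U\<^esub> f \<otimes>\<^bsub>U\<^esub> \<beta> \<otimes>\<^bsub>U\<^esub> f \<in> carrier G"
  using \<beta>[unfolded carrier_G]
proof induction
  case one
  then show ?case using f subgroup.one_closed[OF G_subgroup] by simp
next
  case (incl h)
  then obtain x where "h = R x" "x \<in> Q" by blast
  then show ?case using R_conj[OF f] R_G[OF U.act_closed[OF f]] by simp
next
  case (inv h)
  then obtain x where h: "h = R x" "x \<in> Q" by blast
  have "inv\<^bsub>U\<^esub> f \<otimes>\<^bsub>U\<^esub> inv\<^bsub>U\<^esub> h \<otimes>\<^bsub>U\<^esub> f = inv\<^bsub>U\<^esub> (inv\<^bsub>U\<^esub> f \<otimes>\<^bsub>U\<^esub> h \<otimes>\<^bsub>U\<^esub> f)"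
    using f h R_U by (simp add: U.inv_mult_group U.m_assoc)
  then show ?case
    using R_conj[OF f h(2)] G_inv_closed[OF R_G[OF U.act_closed[OF f h(2)]]] h(1) by simp
next
  case (eng h k)
  have hk: "h \<in> carrier U" "k \<in> carrier U"
    using eng.hyps G_U carrier_G by auto
  have "inv\<^bsub>U\<^esub> f \<otimes>\<^bsub>U\<^esub> (h \<otimes>\<^bsub>U\<^esub> k) \<otimes>\<^bsub>U\<^esub> f
      = (inv\<^bsub>U\<^esub> f \<otimes>\<^bsub>U\<^esub> h \<otimes>\<^bsub>U\<^esub> f) \<otimes>\<^bsub>U\<^esub> (inv\<^bsub>U\<^esub> f \<otimes>\<^bsub>U\<^esub> k \<otimes>\<^bsub>U\<^esub> f)"
    using f hk by (simp add: U.m_assoc U.mult_inv_cancel)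
  then show ?case using eng.IH G_m_closed by simp
qed

section \<open>The stabilizer of \<open>e\<close> and the automorphisms of \<open>G\<close>
  preserving it\<close>

lemma Ge_iff: "\<alpha> \<in> Ge \<longleftrightarrow> \<alpha> \<in> carrier G \<and> \<alpha> e = e"
  by (auto simp: stabilizer_def)

sublocale A: right_perm "carrier G" A
  by (rule right_perm_Aut_fixing) (use e in \<open>auto simp: R_G Ge_iff\<close>)

lemma A_iff: "\<psi> \<in> carrier A \<longleftrightarrow> \<psi> \<in> auto G \<and> \<psi> (R e) = R e \<and> \<psi> ` Ge = Ge"
  by (simp add: Aut_fixing_def)

lemma A_hom: "\<psi> \<in> carrier A \<Longrightarrow> \<psi> \<in> hom G G"
  by (simp add: A_iff auto_def)

lemma A_mult: "\<psi> \<in> carrier A \<Longrightarrow> \<alpha> \<in> carrier G \<Longrightarrow> \<beta> \<in> carrier G \<Longrightarrow>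
    \<psi> (\<alpha> \<otimes>\<^bsub>U\<^esub> \<beta>) = \<psi> \<alpha> \<otimes>\<^bsub>U\<^esub> \<psi> \<beta>"
  using A_hom by (fastforce simp: hom_def)

lemma A_inv: "\<psi> \<in> carrier A \<Longrightarrow> \<alpha> \<in> carrier G \<Longrightarrow> \<psi> (inv\<^bsub>U\<^esub> \<alpha>) = inv\<^bsub>U\<^esub> (\<psi> \<alpha>)"
  using group_hom.hom_inv[of G G \<psi> \<alpha>] A_hom A.act_closed G.group_axioms
  by (simp add: group_hom_def group_hom_axioms_def)

lemma A_Ge: "\<psi> \<in> carrier A \<Longrightarrow> \<alpha> \<in> Ge \<Longrightarrow> \<psi> \<alpha> \<in> Ge"
  by (auto simp: A_iff)

text \<open>Transitivity of \<open>G\<close> enters only here; it reduces claims about points of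
  \<open>Q\<close> to claims about elements of \<open>G\<close>.\<close>

lemma orbit:
  assumes "x \<in> Q" obtains \<beta> where "\<beta> \<in> carrier G" "\<beta> e = x"
  using connected assms e by (auto simp: connected_quandle_def)

section \<open>Automorphisms of \<open>Q\<close> induced by automorphisms of
  \<open>G\<close>\<close>

definition lift :: "(('a \<Rightarrow> 'a) \<Rightarrow> 'a \<Rightarrow> 'a) \<Rightarrow> 'a \<Rightarrow> 'a" where
  "lift \<psi> = (\<lambda>x\<in>Q. \<psi> (SOME \<beta>. \<beta> \<in> carrier G \<and> \<beta> e = x) e)"

text \<open>Independence of the choice made by \<open>SOME\<close>: two elements of \<open>G\<close>
  that agree at \<open>e\<close> differ by an element of \<open>Ge\<close>, and
  \<open>\<psi>\<close> preserves \<open>Ge\<close>.\<close>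

lemma lift_apply:
  assumes \<psi>: "\<psi> \<in> carrier A" and \<beta>: "\<beta> \<in> carrier G"
  shows "lift \<psi> (\<beta> e) = \<psi> \<beta> e"
proof -
  define \<gamma> where "\<gamma> = (SOME \<gamma>. \<gamma> \<in> carrier G \<and> \<gamma> e = \<beta> e)"
  have \<gamma>: "\<gamma> \<in> carrier G" "\<gamma> e = \<beta> e"
    using someI[of "\<lambda>\<gamma>. \<gamma> \<in> carrier G \<and> \<gamma> e = \<beta> e" \<beta>] \<beta> unfolding \<gamma>_def by auto
  have "\<gamma> \<otimes>\<^bsub>U\<^esub> inv\<^bsub>U\<^esub> \<beta> \<in> Ge"
    using \<beta> \<gamma> e by (simp add: Ge_iff G_m_closed G_inv_closed U.act_mult U.act_inv G_U)
  then have "\<psi> \<gamma> \<otimes>\<^bsub>U\<^esub> inv\<^bsub>U\<^esub> (\<psi> \<beta>) \<in> Ge"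
    using A_Ge[OF \<psi>] A_mult[OF \<psi>] A_inv[OF \<psi>] \<beta> \<gamma>(1) G_inv_closed by fastforce
  then have "(inv\<^bsub>U\<^esub> (\<psi> \<beta>)) (\<psi> \<gamma> e) = e"
    using e by (simp add: Ge_iff U.act_mult)
  then have "\<psi> \<gamma> e = \<psi> \<beta> e"
    using U.act_inv'[of "\<psi> \<beta>" "\<psi> \<gamma> e"] \<psi> \<beta> \<gamma>(1) e by (simp add: A.act_closed U.act_closed G_U)
  then show ?thesis
    using U.act_closed[OF G_U[OF \<beta>] e] by (simp add: lift_def \<gamma>_def)
qed

lemma lift_closed:
  assumes "\<psi> \<in> carrier A" "x \<in> Q" shows "lift \<psi> x \<in> Q"
proof -
  obtain \<beta> where "\<beta> \<in> carrier G" "\<beta> e = x" using assms(2) by (rule orbit)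
  then show ?thesis
    using assms lift_apply e by (metis A.act_closed G_U U.act_closed)
qed

lemma lift_base:
  assumes "\<psi> \<in> carrier A" shows "lift \<psi> e = e"
  using lift_apply[OF assms G.one_closed] hom_one[OF A_hom[OF assms] G.group_axioms G.group_axioms] e
  by (simp add: U.act_one)

text \<open>With \<open>x = \<gamma> e\<close> this is multiplicativity of \<open>\<psi>\<close> on
  \<open>\<gamma>\<close> and \<open>\<beta>\<close>. It says that \<open>\<psi> \<beta>\<close> is
  the conjugate of \<open>\<beta>\<close> by \<open>lift \<psi>\<close>.\<close>

lemma lift_conj:
  assumes \<psi>: "\<psi> \<in> carrier A" and \<beta>: "\<beta> \<in> carrier G" and x: "x \<in> Q"
  shows "lift \<psi> (\<beta> x) = \<psi> \<beta> (lift \<psi> x)"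
proof -
  obtain \<gamma> where \<gamma>: "\<gamma> \<in> carrier G" "\<gamma> e = x" using x by (rule orbit)
  have "lift \<psi> (\<beta> x) = lift \<psi> ((\<gamma> \<otimes>\<^bsub>U\<^esub> \<beta>) e)"
    using \<gamma> e by (simp add: U.act_mult)
  also have "\<dots> = (\<psi> \<gamma> \<otimes>\<^bsub>U\<^esub> \<psi> \<beta>) e"
    using \<psi> \<beta> \<gamma> by (simp add: lift_apply G_m_closed A_mult)
  also have "\<dots> = \<psi> \<beta> (lift \<psi> x)"
    using \<psi> \<gamma> e lift_apply by (metis U.act_mult)
  finally show ?thesis .
qed

text \<open>If \<open>\<beta> e = x\<close>, then \<open>R x\<close> is the conjugate of
  \<open>R e\<close> by \<open>\<beta>\<close>. As \<open>\<psi>\<close> fixes \<open>R e\<close>,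
  the image is the conjugate of \<open>R e\<close> by \<open>\<psi> \<beta>\<close>, again a
  translation.\<close>

lemma A_R:
  assumes \<psi>: "\<psi> \<in> carrier A" and x: "x \<in> Q"
  shows "\<psi> (R x) = R (lift \<psi> x)"
proof -
  obtain \<beta> where \<beta>: "\<beta> \<in> carrier G" "\<beta> e = x" using x by (rule orbit)
  have "\<psi> (R x) = \<psi> (inv\<^bsub>U\<^esub> \<beta> \<otimes>\<^bsub>U\<^esub> R e \<otimes>\<^bsub>U\<^esub> \<beta>)"
    using R_conj[OF G_U[OF \<beta>(1)] e] \<beta> by simp
  also have "\<dots> = inv\<^bsub>U\<^esub> (\<psi> \<beta>) \<otimes>\<^bsub>U\<^esub> R e \<otimes>\<^bsub>U\<^esub> \<psi> \<beta>"
    using \<psi> \<beta> e by (simp add: A_mult A_inv G_m_closed G_inv_closed R_G) (simp add: A_iff)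
  also have "\<dots> = R (lift \<psi> x)"
    using R_conj[OF G_U[OF A.act_closed[OF \<psi> \<beta>(1)]] e] lift_apply[OF \<psi> \<beta>(1)] \<beta> by simp
  finally show ?thesis .
qed

lemma lift_mult:
  assumes \<phi>: "\<phi> \<in> carrier A" and \<psi>: "\<psi> \<in> carrier A" and x: "x \<in> Q"
  shows "lift (\<phi> \<otimes>\<^bsub>A\<^esub> \<psi>) x = lift \<psi> (lift \<phi> x)"
proof -
  obtain \<beta> where \<beta>: "\<beta> \<in> carrier G" "\<beta> e = x" using x by (rule orbit)
  have "lift (\<phi> \<otimes>\<^bsub>A\<^esub> \<psi>) (\<beta> e) = lift \<psi> (lift \<phi> (\<beta> e))"
    using \<phi> \<psi> \<beta>(1) by (simp add: lift_apply A.act_mult A.act_closed)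
  then show ?thesis using \<beta> by simp
qed

lemma lift_one: "x \<in> Q \<Longrightarrow> lift \<one>\<^bsub>A\<^esub> x = x"
  by (metis A.act_one A.one_closed lift_apply orbit)

lemma lift_U:
  assumes \<psi>: "\<psi> \<in> carrier A"
  shows "lift \<psi> \<in> carrier U"
proof -
  have inv: "inv\<^bsub>A\<^esub> \<psi> \<in> carrier A" using \<psi> by simp
  \<comment> \<open>Since \<open>lift\<close> is multiplicative, the inverse of
    \<open>\<psi>\<close> lifts to the inverse map.\<close>
  have "bij_betw (lift \<psi>) Q Q"
  proof (rule bij_betwI)
    show "lift \<psi> \<in> Q \<rightarrow> Q" "lift (inv\<^bsub>A\<^esub> \<psi>) \<in> Q \<rightarrow> Q"
      using lift_closed \<psi> inv by auto
    show "lift (inv\<^bsub>A\<^esub> \<psi>) (lift \<psi> x) = x" if "x \<in> Q" for x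
      using lift_mult[OF \<psi> inv that] \<psi> lift_one that by simp
    show "lift \<psi> (lift (inv\<^bsub>A\<^esub> \<psi>) x) = x" if "x \<in> Q" for x
      using lift_mult[OF inv \<psi> that] \<psi> lift_one that by simp
  qed
  moreover have "lift \<psi> \<in> extensional Q" by (simp add: lift_def)
  \<comment> \<open>As \<open>m x y\<close> is \<open>R y x\<close>, \<open>lift_conj\<close> moves
    \<open>R y\<close> past \<open>lift \<psi>\<close>, and \<open>A_R\<close> identifies the
    translation it becomes.\<close>
  moreover have "lift \<psi> (m x y) = m (lift \<psi> x) (lift \<psi> y)" if "x \<in> Q" "y \<in> Q" for x y
    using lift_conj[OF \<psi> R_G[OF that(2)] that(1)] A_R[OF \<psi> that(2)] lift_closed[OF \<psi>] that
    by (simp add: R_apply)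
  ultimately show ?thesis by (simp add: carrier_U quandle_auto_def Bij_def)
qed

sublocale lift: group_hom A U lift
proof unfold_locales
  show "lift \<in> hom A U"
  proof (rule homI)
    fix \<phi> \<psi> assume "\<phi> \<in> carrier A" "\<psi> \<in> carrier A"
    then show "lift (\<phi> \<otimes>\<^bsub>A\<^esub> \<psi>) = lift \<phi> \<otimes>\<^bsub>U\<^esub> lift \<psi>"
      by (intro U.act_ext) (auto simp: lift_U lift_mult U.act_mult)
  qed (rule lift_U)
qed

text \<open>By \<open>lift_conj\<close>, the lift determines \<open>\<phi> \<beta>\<close> at all
  points \<open>lift \<phi> x\<close>, and these exhaust \<open>Q\<close>.\<close>

lemma lift_inj:
  assumes \<phi>: "\<phi> \<in> carrier A" and \<psi>: "\<psi> \<in> carrier A" and eq: "lift \<phi> = lift \<psi>"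
  shows "\<phi> = \<psi>"
proof (rule A.act_ext[OF \<phi> \<psi>])
  fix \<beta> assume \<beta>: "\<beta> \<in> carrier G"
  show "\<phi> \<beta> = \<psi> \<beta>"
  proof (rule U.act_ext)
    fix y assume y: "y \<in> Q"
    define x where "x = (inv\<^bsub>U\<^esub> (lift \<phi>)) y"
    have x: "x \<in> Q" "lift \<phi> x = y"
      using y \<phi> lift_U by (auto simp: x_def U.act_closed U.act_inv')
    show "\<phi> \<beta> y = \<psi> \<beta> y"
      using lift_conj[OF \<phi> \<beta> x(1)] lift_conj[OF \<psi> \<beta> x(1)] eq x by simp
  qed (use \<phi> \<psi> \<beta> in \<open>auto simp: A.act_closed G_U\<close>)
qed

section \<open>Conjugation by automorphisms of \<open>Q\<close> fixing \<open>e\<close>\<close>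

text \<open>Unlike in \<open>conj_by G\<close>, the conjugating element may be any automorphism of
  \<open>Q\<close>, possibly outside \<open>G\<close>.\<close>

definition conj_G :: "('a \<Rightarrow> 'a) \<Rightarrow> ('a \<Rightarrow> 'a) \<Rightarrow> 'a \<Rightarrow> 'a" where
  "conj_G g = (\<lambda>\<beta>\<in>carrier G. inv\<^bsub>U\<^esub> g \<otimes>\<^bsub>U\<^esub> \<beta> \<otimes>\<^bsub>U\<^esub> g)"

lemma conj_by_eq_conj_G: "\<alpha> \<in> carrier G \<Longrightarrow> conj_by G \<alpha> = conj_G \<alpha>"
  by (simp add: conj_by_def conj_G_def)

lemma conj_G_inverse:
  assumes "g \<in> carrier U" "\<beta> \<in> carrier G"
  shows "conj_G (inv\<^bsub>U\<^esub> g) (conj_G g \<beta>) = \<beta>"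
  using assms G_conj[OF assms] by (simp add: conj_G_def U.m_assoc G_U U.mult_inv_cancel)

lemma conj_G_Ge:
  assumes g: "g \<in> carrier U" "g e = e" and \<beta>: "\<beta> \<in> Ge"
  shows "conj_G g \<beta> \<in> Ge"
proof -
  have "(inv\<^bsub>U\<^esub> g) e = e" using U.act_inv[OF g(1) e] g(2) by simp
  then show ?thesis
    using g \<beta> e by (simp add: Ge_iff conj_G_def G_conj U.act_mult)
qed

text \<open>Normality makes the conjugation an automorphism of \<open>G\<close>. It fixes
  \<open>R e\<close> by \<open>R_conj\<close>, and it maps \<open>Ge\<close> onto itself because
  both \<open>g\<close> and its inverse fix \<open>e\<close>.\<close>

lemma conj_G_A:
  assumes g: "g \<in> carrier U" "g e = e"
  shows "conj_G g \<in> carrier A"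
proof -
  have g': "inv\<^bsub>U\<^esub> g \<in> carrier U" "(inv\<^bsub>U\<^esub> g) e = e"
    using U.act_inv[OF g(1) e] g by simp_all
  have closed: "conj_G f \<beta> \<in> carrier G" if "f \<in> carrier U" "\<beta> \<in> carrier G" for f \<beta>
    using that by (simp add: conj_G_def G_conj)
  have inverse: "conj_G g (conj_G (inv\<^bsub>U\<^esub> g) \<beta>) = \<beta>" if "\<beta> \<in> carrier G" for \<beta>
    using conj_G_inverse[OF g'(1) that] g(1) by simp
  have "bij_betw (conj_G g) (carrier G) (carrier G)"
    by (rule bij_betwI[where g = "conj_G (inv\<^bsub>U\<^esub> g)"])
      (use g(1) g'(1) closed inverse conj_G_inverse in auto)
  then have "conj_G g \<in> Bij (carrier G)" by (simp add: Bij_def) (simp add: conj_G_def)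
  moreover have "conj_G g \<in> hom G G"
  proof (rule homI)
    fix \<beta> \<gamma> assume "\<beta> \<in> carrier G" "\<gamma> \<in> carrier G"
    then show "conj_G g (\<beta> \<otimes>\<^bsub>G\<^esub> \<gamma>) = conj_G g \<beta> \<otimes>\<^bsub>G\<^esub> conj_G g \<gamma>"
      using g(1) by (simp add: conj_G_def G_m_closed G_U U.m_assoc U.mult_inv_cancel)
  qed (use closed g(1) in simp)
  moreover have "conj_G g (R e) = R e"
    using R_conj[OF g(1) e] g(2) R_G[OF e] by (simp add: conj_G_def)
  moreover have "conj_G g ` Ge = Ge"
  proof
    show "conj_G g ` Ge \<subseteq> Ge" using conj_G_Ge[OF g] by blast
    show "Ge \<subseteq> conj_G g ` Ge"
      using conj_G_Ge[OF g'] inverse by (metis Ge_iff image_eqI subsetI)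
  qed
  ultimately show ?thesis by (simp add: A_iff auto_def)
qed

text \<open>Following \<open>e\<close> through the conjugate of \<open>\<beta>\<close>:
  \<open>inv g\<close> fixes \<open>e\<close>, \<open>\<beta>\<close> takes it to \<open>x\<close>,
  and \<open>g\<close> takes that to \<open>g x\<close>.\<close>

lemma lift_conj_G:
  assumes g: "g \<in> carrier U" "g e = e"
  shows "lift (conj_G g) = g"
proof (rule U.act_ext)
  fix x assume "x \<in> Q"
  then obtain \<beta> where \<beta>: "\<beta> \<in> carrier G" "\<beta> e = x" by (rule orbit)
  have "(inv\<^bsub>U\<^esub> g) e = e" using U.act_inv[OF g(1) e] g(2) by simp
  then have "conj_G g \<beta> e = g x"
    using \<beta> e by (simp add: conj_G_def U.act_mult)
  then show "lift (conj_G g) x = g x"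
    using lift_apply[OF conj_G_A[OF g] \<beta>(1)] \<beta>(2) by simp
qed (use g lift_U conj_G_A in auto)

section \<open>The epimorphism from the semidirect product onto \<open>Aut(Q)\<close> and its
  kernel\<close>

definition proj :: "('a \<Rightarrow> 'a) \<times> (('a \<Rightarrow> 'a) \<Rightarrow> 'a \<Rightarrow> 'a) \<Rightarrow> 'a \<Rightarrow> 'a" where
  "proj = (\<lambda>(\<alpha>, \<psi>). \<alpha> \<otimes>\<^bsub>U\<^esub> lift \<psi>)"

sublocale proj: group_hom "semidirect G A" U proj
proof -
  interpret S: group "semidirect G A"
    by (rule group_semidirect) (use A_hom in \<open>auto intro: G.group_axioms A.right_perm_axioms\<close>)
  show "group_hom (semidirect G A) U proj"
  proof unfold_locales
    show "proj \<in> hom (semidirect G A) U"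
    proof (rule homI)
      fix p q assume "p \<in> carrier (semidirect G A)" "q \<in> carrier (semidirect G A)"
      then obtain \<alpha> \<phi> \<beta> \<psi> where p: "p = (\<alpha>, \<phi>)" "\<alpha> \<in> carrier G" "\<phi> \<in> carrier A"
        and q: "q = (\<beta>, \<psi>)" "\<beta> \<in> carrier G" "\<psi> \<in> carrier A"
        by (auto simp: semidirect_def)
      \<comment> \<open>The twisted factor in the semidirect product. As
        \<open>\<phi> \<gamma> = \<beta>\<close>, \<open>lift_conj\<close> lets
        \<open>lift \<phi>\<close> pass it, turning \<open>\<gamma>\<close> into
        \<open>\<beta>\<close>.\<close>
      define \<gamma> where "\<gamma> = (inv\<^bsub>A\<^esub> \<phi>) \<beta>"
      have \<gamma>: "\<gamma> \<in> carrier G" "\<phi> \<gamma> = \<beta>"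
        using p q by (auto simp: \<gamma>_def A.act_closed A.act_inv')
      have "\<gamma> \<otimes>\<^bsub>U\<^esub> lift \<phi> = lift \<phi> \<otimes>\<^bsub>U\<^esub> \<beta>"
        by (rule U.act_ext)
          (use p q \<gamma> lift_conj[OF p(3) \<gamma>(1)] in \<open>auto simp: U.act_mult G_U lift_U\<close>)
      then have "\<alpha> \<otimes>\<^bsub>U\<^esub> \<gamma> \<otimes>\<^bsub>U\<^esub> (lift \<phi> \<otimes>\<^bsub>U\<^esub> lift \<psi>) = \<alpha> \<otimes>\<^bsub>U\<^esub> lift \<phi> \<otimes>\<^bsub>U\<^esub> (\<beta> \<otimes>\<^bsub>U\<^esub> lift \<psi>)"
        using p q \<gamma> G_U lift_U by (metis U.m_assoc U.m_closed)
      then show "proj (p \<otimes>\<^bsub>semidirect G A\<^esub> q) = proj p \<otimes>\<^bsub>U\<^esub> proj q"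
        using p q by (simp add: semidirect_def proj_def \<gamma>_def lift.hom_mult)
    qed (auto simp: semidirect_def proj_def G_U lift_U)
  qed
qed

lemma proj_surj: "proj ` carrier (semidirect G A) = carrier U"
proof
  show "proj ` carrier (semidirect G A) \<subseteq> carrier U" using proj.hom_closed by blast
  show "carrier U \<subseteq> proj ` carrier (semidirect G A)"
  proof
    fix f assume f: "f \<in> carrier U"
    then have "(inv\<^bsub>U\<^esub> f) e \<in> Q" using e by (simp add: U.act_closed)
    \<comment> \<open>Choosing \<open>\<beta>\<close> in \<open>G\<close> to agree with
      \<open>inv f\<close> at \<open>e\<close> makes \<open>\<beta>\<close> followed by
      \<open>f\<close> fix \<open>e\<close>; this product is the \<open>g\<close> below, and it is a
      lift.\<close>
    then obtain \<beta> where \<beta>: "\<beta> \<in> carrier G" "\<beta> e = (inv\<^bsub>U\<^esub> f) e" by (rule orbit)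
    define \<alpha> where "\<alpha> = inv\<^bsub>U\<^esub> \<beta>"
    define g where "g = \<beta> \<otimes>\<^bsub>U\<^esub> f"
    have \<alpha>: "\<alpha> \<in> carrier G" using \<beta>(1) by (simp add: \<alpha>_def G_inv_closed)
    have gU: "g \<in> carrier U" using f \<beta> G_U by (simp add: g_def)
    have ge: "g e = e" using \<beta>(2) f e by (simp add: g_def U.act_mult U.act_inv')
    have "\<alpha> \<otimes>\<^bsub>U\<^esub> g = f"
      using f \<beta> G_U by (simp add: \<alpha>_def g_def U.mult_inv_cancel)
    have "proj (\<alpha>, conj_G g) = f"
      using lift_conj_G[OF gU ge] \<open>\<alpha> \<otimes>\<^bsub>U\<^esub> g = f\<close> by (simp add: proj_def)
    then show "f \<in> proj ` carrier (semidirect G A)"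
      using \<alpha> conj_G_A[OF gU ge] by (force simp: semidirect_def)
  qed
qed

lemma proj_kernel:
  "kernel (semidirect G A) U proj = {(\<alpha>, inv\<^bsub>A\<^esub> (conj_by G \<alpha>)) | \<alpha>. \<alpha> \<in> Ge}"
proof -
  have "\<alpha> \<otimes>\<^bsub>U\<^esub> lift \<psi> = \<one>\<^bsub>U\<^esub> \<longleftrightarrow> \<alpha> \<in> Ge \<and> \<psi> = inv\<^bsub>A\<^esub> (conj_G \<alpha>)"
    if \<alpha>: "\<alpha> \<in> carrier G" and \<psi>: "\<psi> \<in> carrier A" for \<alpha> \<psi>
  proof
    assume *: "\<alpha> \<otimes>\<^bsub>U\<^esub> lift \<psi> = \<one>\<^bsub>U\<^esub>"
    have "lift \<psi> (\<alpha> e) = e" using arg_cong[OF *, of "\<lambda>f. f e"] e by (simp add: U.act_mult U.act_one)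
    moreover have "lift \<psi> e = e" using \<psi> by (rule lift_base)
    \<comment> \<open>The injective map \<open>lift \<psi>\<close> sends both
      \<open>\<alpha> e\<close> and \<open>e\<close> to \<open>e\<close>.\<close>
    ultimately have "\<alpha> e = e"
      using U.act_inj[OF lift_U[OF \<psi>]] U.act_closed[OF G_U[OF \<alpha>] e] e by metis
    then have c: "conj_G \<alpha> \<in> carrier A" "lift (conj_G \<alpha>) = \<alpha>"
      using conj_G_A lift_conj_G G_U[OF \<alpha>] by auto
    \<comment> \<open>Replacing \<open>\<alpha>\<close> by the lift of its conjugation turns the
      assumption into an equation between lifts, where \<open>lift_inj\<close> applies.\<close>
    have "lift (conj_G \<alpha> \<otimes>\<^bsub>A\<^esub> \<psi>) = lift \<one>\<^bsub>A\<^esub>"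
      using c \<psi> * by (simp add: lift.hom_mult)
    then have "conj_G \<alpha> \<otimes>\<^bsub>A\<^esub> \<psi> = \<one>\<^bsub>A\<^esub>"
      using lift_inj c(1) \<psi> by (metis A.m_closed A.one_closed)
    then show "\<alpha> \<in> Ge \<and> \<psi> = inv\<^bsub>A\<^esub> (conj_G \<alpha>)"
      using \<alpha> \<open>\<alpha> e = e\<close> c(1) \<psi> A.inv_equality[of "conj_G \<alpha>" \<psi>]
      by (metis A.inv_inv Ge_iff)
  next
    assume *: "\<alpha> \<in> Ge \<and> \<psi> = inv\<^bsub>A\<^esub> (conj_G \<alpha>)"
    then have "conj_G \<alpha> \<in> carrier A" "lift (conj_G \<alpha>) = \<alpha>"
      using conj_G_A lift_conj_G G_U[OF \<alpha>] by (auto simp: Ge_iff)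
    then show "\<alpha> \<otimes>\<^bsub>U\<^esub> lift \<psi> = \<one>\<^bsub>U\<^esub>"
      using * G_U[OF \<alpha>] by (simp add: lift.hom_inv)
  qed
  \<comment> \<open>This places the pairs on the right-hand side in the carrier of the semidirect
    product, as membership in the kernel demands.\<close>
  moreover have "inv\<^bsub>A\<^esub> (conj_G \<alpha>) \<in> carrier A" if "\<alpha> \<in> Ge" for \<alpha>
    using that conj_G_A G_U by (simp add: Ge_iff)
  ultimately show ?thesis
    by (fastforce simp: kernel_def semidirect_def proj_def Ge_iff conj_by_eq_conj_G)
qed

end

theorem proposition5p8:
  fixes Q :: "'a set" and m :: "'a \<Rightarrow> 'a \<Rightarrow> 'a" and e :: 'a
    and G :: "('a \<Rightarrow> 'a) monoid" and Ge :: "('a \<Rightarrow> 'a) set"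
    and A :: "(('a \<Rightarrow> 'a) \<Rightarrow> 'a \<Rightarrow> 'a) monoid"
    and N :: "(('a \<Rightarrow> 'a) \<times> (('a \<Rightarrow> 'a) \<Rightarrow> 'a \<Rightarrow> 'a)) set"
  assumes "connected_quandle Q m" and "e \<in> Q"
    and "G = RMlt Q m"
    and "Ge = stabilizer G (\<lambda>\<alpha>. \<alpha>) e"
    and "A = Aut_fixing G (right_translation Q m e) Ge"
    and "N = {(\<alpha>, inv\<^bsub>A\<^esub> (conj_by G \<alpha>)) | \<alpha>. \<alpha> \<in> Ge}"
  shows "N \<lhd> semidirect G A \<and> quandle_Aut Q m \<cong> semidirect G A Mod N"
proof -
  interpret pointed_connected_quandle Q m e
    by unfold_locales (use assms in auto)
  have N: "N = kernel (semidirect G A) (quandle_Aut Q m) proj"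
    using proj_kernel assms by simp
  have "N \<lhd> semidirect G A"
    using proj.normal_kernel N assms by simp
  moreover from this have "group (semidirect G A Mod N)"
    by (rule normal.factorgroup_is_group)
  \<comment> \<open>The first isomorphism theorem gives the map out of the quotient;
    \<open>iso_sym\<close> reverses it, using that the quotient is a group.\<close>
  moreover have "semidirect G A Mod N \<cong> quandle_Aut Q m"
    using proj.FactGroup_iso[OF proj_surj] N assms by simp
  ultimately show ?thesis
    using group.iso_sym by blast
qed

end
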